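(* Let $A\in\mathbb{R}^{m\times n}$ and $L\in\mathbb{R}^{p\times n}$ be any two matrices, let $G=A^{\top}A+L^{\top}L$, and let $A=U_A\Sigma_AX^{-1}$, $L=U_L\Sigma_LX^{-1}$ be the generalized singular value decomposition (GSVD) of $\{A,L\}$. Then the $I_mL$-weighted pseudoinverse $A_{IL}^{\dagger}$ of $A$ satisfies $$A_{IL}^{\dagger}=\mathcal{P}_{\mathcal{R}(G)}X\Sigma_A^{\dagger}U_A^{\top}.$$
   Context: $\mathcal{R}(\cdot)$, $\mathcal{N}(\cdot)$ denote range and null space, $\mathcal{P}_{\mathcal{S}}$ is the Euclidean orthogonal projector onto $\mathcal{S}$, and $\dagger$ on a matrix without subscript is the usual Moore-Penrose pseudoinverse. The weighted pseudoinverse with $M=I_m$ is $$A_{IL}^{\dagger}:=(I_n-(L\mathcal{P}_{\mathcal{N}(A)})^{\dagger}L)A^{\dagger}\in\mathbb{R}^{n\times m}.$$ GSVD: $U_A\in\mathbb{R}^{m\times m}$ and $U_L\in\mathbb{R}^{p\times p}$ are orthogonal, $X\in\mathbb{R}^{n\times n}$ is invertible, and with $r=\mathrm{rank}\begin{pmatrix}A\\L\end{pmatrix}=q_1+q_2+q_3$, $$\Sigma_A=(C_A\ \ \mathbf{0})\in\mathbb{R}^{m\times n},\qquad \Sigma_L=(S_L\ \ \mathbf{0})\in\mathbb{R}^{p\times n},$$ where $C_A\in\mathbb{R}^{m\times r}$ and $S_L\in\mathbb{R}^{p\times r}$ (zero blocks have $n-r$ columns) are block diagonal, $$C_A=\begin{pmatrix}I_{q_1}&&\\&C_{q_2}&\\&&\mathbf{0}\end{pmatrix},\qquad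 S_L=\begin{pmatrix}\mathbf{0}&&\\&S_{q_2}&\\&&I_{q_3}\end{pmatrix},$$ with column block sizes $q_1,q_2,q_3$, row block sizes $q_1,q_2,m-q_1-q_2$ for $C_A$ and $p-r+q_1,q_2,q_3$ for $S_L$; $C_{q_2},S_{q_2}\in\mathbb{R}^{q_2\times q_2}$ are diagonal with positive diagonal entries; and $C_A^{\top}C_A+S_L^{\top}S_L=I_r$. Such a decomposition always exists. *)

theory Defs
  imports
    "Jordan_Normal_Form.Matrix_Kernel"
    "Jordan_Normal_Form.DL_Rank"
begin

definition is_pinv :: "real mat \<Rightarrow> real mat \<Rightarrow> bool" where
  "is_pinv A B \<longleftrightarrow>
     B \<in> carrier_mat (dim_col A) (dim_row A) \<and>
     A * B * A = A \<and> B * A * B = B \<and>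
     (A * B)\<^sup>T = A * B \<and> (B * A)\<^sup>T = B * A"

definition pinv :: "real mat \<Rightarrow> real mat" where
  "pinv A = (THE B. is_pinv A B)"

definition mat_range :: "real mat \<Rightarrow> real vec set" where
  "mat_range A = (\<lambda>x. A *\<^sub>v x) ` carrier_vec (dim_col A)"

(* P x is the point of S with x - P x orthogonal to S; only used for subspaces S of R^n,
   where it exists and is unique. *)
definition is_orth_proj :: "nat \<Rightarrow> real vec set \<Rightarrow> real mat \<Rightarrow> bool" where
  "is_orth_proj n S P \<longleftrightarrow>
     P \<in> carrier_mat n n \<and>
     (\<forall>x \<in> carrier_vec n. P *\<^sub>v x \<in> S \<and> (\<forall>s \<in> S. s \<bullet> (x - P *\<^sub>v x) = 0))"

definition orth_proj :: "nat \<Rightarrow> real vec set \<Rightarrow> real mat" where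
  "orth_proj n S = (THE P. is_orth_proj n S P)"

definition weighted_pinv_I :: "real mat \<Rightarrow> real mat \<Rightarrow> real mat" where
  "weighted_pinv_I A L =
     (let n = dim_col A
      in (1\<^sub>m n - pinv (L * orth_proj n (mat_kernel A)) * L) * pinv A)"

(* The library's orthogonal_mat and corthogonal_mat only ask for pairwise orthogonal nonzero
   columns; here the columns are orthonormal. *)
definition is_orthogonal :: "nat \<Rightarrow> real mat \<Rightarrow> bool" where
  "is_orthogonal k U \<longleftrightarrow> U \<in> carrier_mat k k \<and> U\<^sup>T * U = 1\<^sub>m k \<and> U * U\<^sup>T = 1\<^sub>m k"

definition append_zero_cols :: "real mat \<Rightarrow> nat \<Rightarrow> real mat" where
  "append_zero_cols B k =
     four_block_mat B (0\<^sub>m (dim_row B) k) (0\<^sub>m 0 (dim_col B)) (0\<^sub>m 0 k)"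

definition pos_diagonal :: "nat \<Rightarrow> real mat \<Rightarrow> bool" where
  "pos_diagonal q D \<longleftrightarrow> D \<in> carrier_mat q q \<and> diagonal_mat D \<and> (\<forall>i < q. D $$ (i, i) > 0)"

(* The bounds q1 + q2 <= m, q2 + q3 <= p and r <= n make every subtraction below a true one;
   with r = q1 + q2 + q3, the first row block of S_L has p - r + q1 = p - (q2 + q3) rows. *)
definition is_gsvd ::
  "nat \<Rightarrow> nat \<Rightarrow> nat \<Rightarrow> real mat \<Rightarrow> real mat \<Rightarrow>
   real mat \<Rightarrow> real mat \<Rightarrow> real mat \<Rightarrow> real mat \<Rightarrow> real mat \<Rightarrow> bool" where
  "is_gsvd m n p A L U\<^sub>A \<Sigma>\<^sub>A U\<^sub>L \<Sigma>\<^sub>L X \<longleftrightarrow>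
     is_orthogonal m U\<^sub>A \<and> is_orthogonal p U\<^sub>L \<and>
     X \<in> carrier_mat n n \<and> invertible_mat X \<and>
     (\<exists>q1 q2 q3 r Cq Sq C\<^sub>A S\<^sub>L.
        r = vec_space.rank (m + p) (A @\<^sub>r L) \<and> r = q1 + q2 + q3 \<and>
        r \<le> n \<and> q1 + q2 \<le> m \<and> q2 + q3 \<le> p \<and>
        pos_diagonal q2 Cq \<and> pos_diagonal q2 Sq \<and>
        C\<^sub>A = diag_block_mat [1\<^sub>m q1, Cq, 0\<^sub>m (m - (q1 + q2)) q3] \<and>
        S\<^sub>L = diag_block_mat [0\<^sub>m (p - (q2 + q3)) q1, Sq, 1\<^sub>m q3] \<and>
        C\<^sub>A\<^sup>T * C\<^sub>A + S\<^sub>L\<^sup>T * S\<^sub>L = 1\<^sub>m r \<and>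
        \<Sigma>\<^sub>A = append_zero_cols C\<^sub>A (n - r) \<and>
        \<Sigma>\<^sub>L = append_zero_cols S\<^sub>L (n - r)) \<and>
     A = U\<^sub>A * \<Sigma>\<^sub>A * the (mat_inverse X) \<and>
     L = U\<^sub>L * \<Sigma>\<^sub>L * the (mat_inverse X)"

end

theory Submission
  imports Defs
begin

text \<open>\<open>B = weighted_pinv_I A L\<close> is determined by three conditions: \<open>A * B = A * pinv A\<close> (least squares),
  \<open>L * B\<close> is orthogonal to \<open>L\<close> restricted to the null space of \<open>A\<close> (minimal \<open>L\<close>-seminorm), and the
  range of \<open>B\<close> lies in the range of \<open>G\<close> (minimal norm). Two solutions differ by a \<open>D\<close>
  with \<open>A * D = 0\<close> and \<open>L * D = 0\<close>, hence \<open>G * D = 0\<close>, while the columns of \<open>D\<close> lie in the range of the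
  symmetric \<open>G\<close>, so \<open>D = 0\<close>. Of the GSVD, verifying the conditions for the right-hand side needs only
  that \<open>\<Sigma>\<^sub>A\<^sup>T * \<Sigma>\<^sub>A + \<Sigma>\<^sub>L\<^sup>T * \<Sigma>\<^sub>L\<close> is a symmetric matrix that acts on \<open>\<Sigma>\<^sub>A\<close>
  from the right as the identity.\<close>

section \<open>Matrix identities with dimension side conditions\<close>

text \<open>Side conditions that are equations between dimensions can be discharged by rewriting;
  carrier premises would mention sizes that do not occur in the rewritten equation.\<close>

lemma assoc_mult_mat_dim:
  "dim_col A = dim_row B \<Longrightarrow> dim_col B = dim_row C \<Longrightarrow> A * B * C = A * (B * C)"
  for A B C :: "'a :: semiring_0 mat"
  by (rule assoc_mult_mat) auto

lemma transpose_mult_dim: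
  "dim_col A = dim_row B \<Longrightarrow> (A * B)\<^sup>T = B\<^sup>T * A\<^sup>T"
  for A B :: "'a :: comm_semiring_0 mat"
  by (rule transpose_mult) auto

lemma mult_minus_distrib_mat_dim:
  "dim_col A = dim_row B \<Longrightarrow> dim_row B = dim_row C \<Longrightarrow> dim_col B = dim_col C \<Longrightarrow>
    A * (B - C) = A * B - A * C"
  for A B C :: "'a :: ring mat"
  by (rule mult_minus_distrib_mat) auto

lemma minus_mult_distrib_mat_dim:
  "dim_row A = dim_row B \<Longrightarrow> dim_col A = dim_col B \<Longrightarrow> dim_col A = dim_row C \<Longrightarrow>
    (A - B) * C = A * C - B * C"
  for A B C :: "'a :: ring mat"
  by (rule minus_mult_distrib_mat) auto

lemma add_mult_distrib_mat_dim:
  "dim_row A = dim_row B \<Longrightarrow> dim_col A = dim_col B \<Longrightarrow> dim_col A = dim_row C \<Longrightarrow>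
    (A + B) * C = A * C + B * C"
  for A B C :: "'a :: semiring_0 mat"
  by (rule add_mult_distrib_mat) auto

lemma transpose_minus_dim:
  "dim_row A = dim_row B \<Longrightarrow> dim_col A = dim_col B \<Longrightarrow> (A - B)\<^sup>T = A\<^sup>T - B\<^sup>T"
  for A B :: "'a :: group_add mat"
  by (rule transpose_minus) auto

lemmas mat_dim_simps = assoc_mult_mat_dim transpose_mult_dim mult_minus_distrib_mat_dim
  minus_mult_distrib_mat_dim add_mult_distrib_mat_dim transpose_minus_dim

lemma mult_zero_mat_dim [simp]:
  "dim_col A = n \<Longrightarrow> A * 0\<^sub>m n k = 0\<^sub>m (dim_row A) k" "dim_row A = n \<Longrightarrow> 0\<^sub>m k n * A = 0\<^sub>m k (dim_col A)"
  for A :: "'a :: semiring_0 mat"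
  by auto

text \<open>A difference takes its dimensions from the second operand, so agreement with those of
  \<open>A\<close> has to be assumed.\<close>

lemma minus_eq_zero_matD:
  fixes A B :: "'a :: group_add mat"
  assumes "A - B = 0\<^sub>m k l" "dim_row A = dim_row B" "dim_col A = dim_col B"
  shows "A = B"
proof (rule eq_matI)
  fix i j assume ij: "i < dim_row B" "j < dim_col B"
  have "dim_row (A - B) = k" "dim_col (A - B) = l" unfolding assms(1) by simp_all
  hence "(0\<^sub>m k l :: 'a mat) $$ (i, j) = 0" using ij by simp
  hence "(A - B) $$ (i, j) = 0" unfolding assms(1) .
  thus "A $$ (i, j) = B $$ (i, j)" using ij by simp
qed (use assms in auto)

lemma minus_self_mat_dim [simp]: "A - A = 0\<^sub>m (dim_row A) (dim_col A)"
  for A :: "'a :: group_add mat"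
  by (rule eq_matI) auto

lemma minus_zero_mat_dim [simp]:
  "dim_row A = k \<Longrightarrow> dim_col A = l \<Longrightarrow> A - 0\<^sub>m k l = A"
  for A :: "'a :: group_add mat"
  by (rule eq_matI) auto

text \<open>Diagonal entry \<open>j\<close> of the sum adds up the squares of all entries in column
  \<open>j\<close> of \<open>B\<close> and of \<open>C\<close>; over the reals it vanishes only if
  each of these entries does.\<close>

lemma sum_gram_eq_zero:
  fixes B C :: "real mat"
  assumes "dim_col B = k" "dim_col C = k" "B\<^sup>T * B + C\<^sup>T * C = 0\<^sub>m k k"
  shows "B = 0\<^sub>m (dim_row B) k" "C = 0\<^sub>m (dim_row C) k"
proof -
  have "(\<forall>i < dim_row B. B $$ (i, j) = 0) \<and> (\<forall>i < dim_row C. C $$ (i, j) = 0)"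
    if j: "j < k" for j
  proof -
    have "(B\<^sup>T * B + C\<^sup>T * C) $$ (j, j) = 0" using assms(3) j by simp
    hence "(\<Sum>i<dim_row B. (B $$ (i, j))\<^sup>2) + (\<Sum>i<dim_row C. (C $$ (i, j))\<^sup>2) = 0"
      using j assms(1,2) by (simp add: scalar_prod_def atLeast0LessThan power2_eq_square)
    hence "(\<Sum>i<dim_row B. (B $$ (i, j))\<^sup>2) = 0 \<and> (\<Sum>i<dim_row C. (C $$ (i, j))\<^sup>2) = 0"
      by (simp add: add_nonneg_eq_0_iff sum_nonneg)
    thus ?thesis by (simp add: sum_nonneg_eq_0_iff)
  qed
  thus "B = 0\<^sub>m (dim_row B) k" "C = 0\<^sub>m (dim_row C) k"
    using assms(1,2) by (auto intro!: eq_matI)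
qed

text \<open>Multiplying the hypothesis by \<open>B\<^sup>T\<close> from the left produces the Gram
  matrix of \<open>A * B\<close>.\<close>

lemma gram_mult_eq_zero:
  fixes A B :: "real mat"
  assumes "dim_col A = dim_row B" "A\<^sup>T * (A * B) = 0\<^sub>m (dim_col A) (dim_col B)"
  shows "A * B = 0\<^sub>m (dim_row A) (dim_col B)"
proof -
  have "(A * B)\<^sup>T * (A * B) = 0\<^sub>m (dim_col B) (dim_col B)"
    using assms by (simp add: mat_dim_simps)
  \<comment> \<open>Doubled to fit \<open>sum_gram_eq_zero\<close> with both matrices equal to
    \<open>A * B\<close>.\<close>
  hence "(A * B)\<^sup>T * (A * B) + (A * B)\<^sup>T * (A * B) = 0\<^sub>m (dim_col B) (dim_col B)"
    by simp
  from sum_gram_eq_zero(1)[OF _ _ this] show ?thesis by simp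
qed

section \<open>Existence of the Moore-Penrose inverse\<close>

text \<open>For the reduced echelon form \<open>R = P * A\<close> with pivots \<open>f\<close>, let \<open>E\<close> map the
  \<open>i\<close>-th unit vector to the \<open>f i\<close>-th one; then \<open>R * E * R = R\<close>.\<close>

lemma ex_generalized_inverse:
  fixes A :: "'a :: field mat"
  assumes A: "A \<in> carrier_mat m n"
  shows "\<exists>E \<in> carrier_mat n m. A * E * A = A"
proof -
  define R where "R = gauss_jordan_single A"
  note gj = gauss_jordan_single[OF A R_def[symmetric]]
  from gj(4) obtain P Q where R: "R = P * A" and P: "P \<in> carrier_mat m m"
    and Q: "Q \<in> carrier_mat m m" and QP: "Q * P = 1\<^sub>m m" by blast
  have Rc: "R \<in> carrier_mat m n" by (rule gj(2))
  from gj(3) Rc obtain f where f: "pivot_fun R f n" unfolding row_echelon_form_def by auto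
  have dR: "dim_row R = m" "dim_col R = n" using Rc by auto
  note piv = pivot_funD[OF dR(1) f]
  define E :: "'a mat" where "E = mat n m (\<lambda>(j, i). if j = f i then 1 else 0)"
  have E: "E \<in> carrier_mat n m" by (simp add: E_def)
  \<comment> \<open>Column \<open>k\<close> of \<open>R * E\<close> is the pivot column
    \<open>f k\<close> of \<open>R\<close>, a unit vector. The value \<open>f k = n\<close> marks a
    zero row of \<open>R\<close>; column \<open>k\<close> of \<open>E\<close> is then zero.\<close>
  have RE: "(R * E) $$ (i, k) = (if i = k \<and> f k < n then 1 else 0)" if "i < m" "k < m" for i k
  proof -
    have "(R * E) $$ (i, k) = (\<Sum>j<n. R $$ (i, j) * (if j = f k then 1 else 0))"
      using that dR by (simp add: E_def scalar_prod_def atLeast0LessThan)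
    also have "\<dots> = (if f k < n then R $$ (i, f k) else 0)"
      by (simp add: if_distrib[of "\<lambda>x. _ * x"] cong: if_cong)
    finally show ?thesis using piv(4)[of k] piv(5)[of k i] that by auto
  qed
  have RER: "(R * E) * R = R" (is "?T * R = R")
  proof (rule eq_matI)
    fix i j assume "i < dim_row R" "j < dim_col R"
    hence ij: "i < m" "j < n" using dR by auto
    have "?T \<in> carrier_mat m m" using Rc E by simp
    hence "(?T * R) $$ (i, j) = (\<Sum>k\<in>{0..<m}. row ?T i $ k * col R j $ k)"
      using ij dR by (simp only: index_mult_mat carrier_matD scalar_prod_def dim_col)
    also have "\<dots> = (\<Sum>k\<in>{0..<m}. if k = i then (if f i < n then R $$ (i, j) else 0) else 0)"
    proof (rule sum.cong[OF refl])
      fix k assume "k \<in> {0..<m}"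
      hence k: "k < m" by simp
      have "row ?T i $ k = ?T $$ (i, k)" using ij k dR E by (intro index_row) auto
      thus "row ?T i $ k * col R j $ k = (if k = i then (if f i < n then R $$ (i, j) else 0) else 0)"
        using ij k dR RE[OF ij(1) k] by auto
    qed
    also have "\<dots> = (if f i < n then R $$ (i, j) else 0)"
      using ij by simp
    also have "\<dots> = R $$ (i, j)"
      using piv(1)[of i] piv(2)[of i j] ij by (cases "f i < n") auto
    finally show "(?T * R) $$ (i, j) = R $$ (i, j)" .
  qed (use dR E in auto)
  have AQR: "Q * R = A" using A P Q QP
    by (simp add: R assoc_mult_mat_dim[symmetric] del: assoc_mult_mat)
  have "A * (E * P) * A = A * (E * R)"
    using A P E by (simp add: R assoc_mult_mat_dim)
  also have "\<dots> = Q * R * (E * R)" unfolding AQR ..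
  also have "\<dots> = Q * (R * E * R)"
    using Q E Rc by (simp add: assoc_mult_mat_dim)
  finally have "A * (E * P) * A = Q * (R * E * R)" .
  hence "A * (E * P) * A = A" using RER AQR by simp
  thus ?thesis using E P by (intro bexI[of _ "E * P"]) auto
qed

text \<open>For a generalized inverse \<open>E\<close> of \<open>A\<^sup>T * A\<close>, the factor
  \<open>A\<^sup>T\<close> can be cancelled from
  \<open>A\<^sup>T * A * E * A\<^sup>T * A = A\<^sup>T * A\<close> by
  \<open>gram_mult_eq_zero\<close>.\<close>

lemma ex_sym_range_projector:
  fixes A :: "real mat"
  shows "\<exists>E \<in> carrier_mat (dim_col A) (dim_col A).
    A * E * A\<^sup>T * A = A \<and> (A * E * A\<^sup>T)\<^sup>T = A * E * A\<^sup>T"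
proof -
  define S where "S = A\<^sup>T * A"
  have "S \<in> carrier_mat (dim_col A) (dim_col A)" by (auto simp: S_def)
  from ex_generalized_inverse[OF this] obtain E
    where E: "E \<in> carrier_mat (dim_col A) (dim_col A)" and S: "S * E * S = S" by blast
  have dE [simp]: "dim_row E = dim_col A" "dim_col E = dim_col A" using E by auto
  have "A\<^sup>T * (A * (E * (A\<^sup>T * A) - 1\<^sub>m (dim_col A))) = 0\<^sub>m (dim_col A) (dim_col A)"
    using S by (simp add: S_def mat_dim_simps)
  hence "A * (E * (A\<^sup>T * A) - 1\<^sub>m (dim_col A)) = 0\<^sub>m (dim_row A) (dim_col A)"
    using gram_mult_eq_zero[of A "E * (A\<^sup>T * A) - 1\<^sub>m (dim_col A)"] by simp
  hence "A * (E * (A\<^sup>T * A)) - A = 0\<^sub>m (dim_row A) (dim_col A)"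
    by (simp add: mat_dim_simps)
  hence AEA: "A * (E * (A\<^sup>T * A)) = A" by (rule minus_eq_zero_matD) auto
  define P where "P = A * E * A\<^sup>T"
  have dP [simp]: "dim_row P = dim_row A" "dim_col P = dim_row A" by (auto simp: P_def)
  have PA: "P * A = A" using AEA by (simp add: P_def assoc_mult_mat_dim)
  \<comment> \<open>Since \<open>E\<close> is an arbitrary generalized inverse, symmetry of
    \<open>P\<close> is obtained from \<open>P * P\<^sup>T = P\<^sup>T\<close>, whose left side is
    symmetric.\<close>
  have "P * P\<^sup>T = (P * A) * (E\<^sup>T * A\<^sup>T)"
    by (simp add: P_def mat_dim_simps)
  also have "\<dots> = P\<^sup>T" unfolding PA by (simp add: P_def mat_dim_simps)
  finally have PP: "P * P\<^sup>T = P\<^sup>T" .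
  have "(P * P\<^sup>T)\<^sup>T = P * P\<^sup>T" by (simp add: transpose_mult_dim)
  hence "P\<^sup>T = P" unfolding PP by simp
  with PA E show ?thesis unfolding P_def by blast
qed

text \<open>The symmetric projectors \<open>A * E * A\<^sup>T\<close> and
  \<open>A\<^sup>T * F * A\<close> onto the column and row space of \<open>A\<close> are glued into
  one \<open>B\<close>, chosen so that they become \<open>A * B\<close> and
  \<open>B * A\<close>.\<close>

lemma ex_is_pinv: "\<exists>B. is_pinv A B"
proof -
  from ex_sym_range_projector[of A] obtain E
    where E: "E \<in> carrier_mat (dim_col A) (dim_col A)"
      and E1: "A * E * A\<^sup>T * A = A" and E2: "(A * E * A\<^sup>T)\<^sup>T = A * E * A\<^sup>T" by blast
  from ex_sym_range_projector[of "A\<^sup>T"] obtain F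
    where F: "F \<in> carrier_mat (dim_row A) (dim_row A)"
      and F1: "A\<^sup>T * F * A * A\<^sup>T = A\<^sup>T" and F2: "(A\<^sup>T * F * A)\<^sup>T = A\<^sup>T * F * A"
    by auto
  have d [simp]: "dim_row E = dim_col A" "dim_col E = dim_col A"
    "dim_row F = dim_row A" "dim_col F = dim_row A" using E F by auto
  define B where "B = A\<^sup>T * F * A * E * A\<^sup>T"
  have "A * (A\<^sup>T * F * A) = (A\<^sup>T * F * A * A\<^sup>T)\<^sup>T"
    by (simp add: transpose_mult_dim[of "A\<^sup>T * F * A"] F2)
  hence F3: "A * (A\<^sup>T * F * A) = A" unfolding F1 by simp
  have "A * B = A * (A\<^sup>T * F * A) * E * A\<^sup>T" by (simp add: B_def assoc_mult_mat_dim)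
  hence AB: "A * B = A * E * A\<^sup>T" unfolding F3 .
  have "B * A = A\<^sup>T * F * (A * E * A\<^sup>T * A)" by (simp add: B_def assoc_mult_mat_dim)
  hence BA: "B * A = A\<^sup>T * F * A" unfolding E1 .
  have "B * A * B = A\<^sup>T * F * A * A\<^sup>T * F * A * E * A\<^sup>T"
    unfolding BA by (simp add: B_def assoc_mult_mat_dim)
  also have "\<dots> = B" unfolding F1 B_def ..
  finally have "B * A * B = B" .
  moreover have "B \<in> carrier_mat (dim_col A) (dim_row A)" by (auto simp: B_def)
  ultimately show ?thesis
    using AB BA E1 E2 F2 unfolding is_pinv_def by metis
qed

text \<open>Transposing \<open>A * B = (A * C) * (A * B)\<close> swaps the symmetric factors, which
  gives \<open>A * B = A * C\<close>; likewise \<open>B * A = C * A\<close>. Hence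
  \<open>B = B * A * B = C * A * C = C\<close>.\<close>

lemma is_pinv_unique:
  assumes "is_pinv A B" "is_pinv A C"
  shows "B = C"
proof -
  have B: "A * B * A = A" "B * A * B = B" "(A * B)\<^sup>T = A * B" "(B * A)\<^sup>T = B * A"
    and C: "A * C * A = A" "C * A * C = C" "(A * C)\<^sup>T = A * C" "(C * A)\<^sup>T = C * A"
    and [simp]: "dim_row B = dim_col A" "dim_col B = dim_row A"
      "dim_row C = dim_col A" "dim_col C = dim_row A"
    using assms by (auto simp: is_pinv_def)
  have "A * B = (A * B)\<^sup>T" by (simp add: B)
  also have "\<dots> = ((A * C) * (A * B))\<^sup>T"
    using C(1) by (simp add: assoc_mult_mat_dim[symmetric] del: assoc_mult_mat)
  also have "\<dots> = (A * B) * (A * C)" using B C by (simp add: transpose_mult_dim[of "A * C"])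
  also have "\<dots> = A * C"
    using B(1) by (simp add: assoc_mult_mat_dim[symmetric] del: assoc_mult_mat)
  finally have AB: "A * B = A * C" .
  have "B * A = (B * A)\<^sup>T" by (simp add: B)
  also have "\<dots> = ((B * A) * (C * A))\<^sup>T"
    using C(1) by (simp add: assoc_mult_mat_dim)
  also have "\<dots> = (C * A) * (B * A)" using B C by (simp add: transpose_mult_dim[of "B * A"])
  also have "\<dots> = C * A" using B(1) by (simp add: assoc_mult_mat_dim)
  finally have BA: "B * A = C * A" .
  have "B = C * (A * B)" using B(2) by (simp add: BA assoc_mult_mat_dim)
  also have "\<dots> = C" using C(2) by (simp add: AB assoc_mult_mat_dim)
  finally show ?thesis .
qed

section \<open>Penrose identities and their consequences\<close>

lemma is_pinv_pinv: "is_pinv A (pinv A)"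
  unfolding pinv_def using ex_is_pinv is_pinv_unique by (metis theI)

lemma pinv_dim [simp]: "dim_row (pinv A) = dim_col A" "dim_col (pinv A) = dim_row A"
  using is_pinv_pinv[of A] by (auto simp: is_pinv_def)

lemma pinv_carrier_mat: "A \<in> carrier_mat m n \<Longrightarrow> pinv A \<in> carrier_mat n m"
  by (metis carrier_matD carrier_matI pinv_dim)

lemma mult_pinv_mult: "A * (pinv A * A) = A"
  using is_pinv_pinv[of A] by (simp add: is_pinv_def assoc_mult_mat_dim)

lemma pinv_mult_pinv: "pinv A * (A * pinv A) = pinv A"
  using is_pinv_pinv[of A] by (simp add: is_pinv_def assoc_mult_mat_dim)

lemma transpose_mult_pinv: "(A * pinv A)\<^sup>T = A * pinv A"
  using is_pinv_pinv[of A] by (simp add: is_pinv_def)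

lemma transpose_pinv_mult: "(pinv A * A)\<^sup>T = pinv A * A"
  using is_pinv_pinv[of A] by (simp add: is_pinv_def)

text \<open>Used to transfer invariance: a matrix that fixes \<open>A\<^sup>T\<close> under
  multiplication from the left also fixes \<open>pinv A\<close>.\<close>

lemma pinv_eq_transpose_mult: "pinv A = A\<^sup>T * ((pinv A)\<^sup>T * pinv A)"
proof -
  have "pinv A = (pinv A * A)\<^sup>T * pinv A"
    unfolding transpose_pinv_mult using pinv_mult_pinv[of A] by (simp add: assoc_mult_mat_dim)
  thus ?thesis by (simp add: mat_dim_simps)
qed

text \<open>The normal equations of least squares: the transpose of
  \<open>A * pinv A * A = A\<close>, with \<open>A * pinv A\<close> symmetric.\<close>

lemma transpose_mult_mult_pinv: "A\<^sup>T * (A * pinv A) = A\<^sup>T"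
proof -
  have "A\<^sup>T * (A * pinv A)\<^sup>T = (A * pinv A * A)\<^sup>T"
    by (simp only: transpose_mult_dim[of "A * pinv A" A, symmetric] index_mult_mat pinv_dim)
  thus ?thesis unfolding transpose_mult_pinv by (simp add: assoc_mult_mat_dim mult_pinv_mult)
qed

section \<open>Orthogonal projectors\<close>

lemma eq_mat_by_vec:
  fixes A B :: "'a :: semiring_1 mat"
  assumes A: "A \<in> carrier_mat m n" and B: "B \<in> carrier_mat m n"
    and eq: "\<And>x. x \<in> carrier_vec n \<Longrightarrow> A *\<^sub>v x = B *\<^sub>v x"
  shows "A = B"
proof (rule eq_matI)
  fix i j assume "i < dim_row B" "j < dim_col B"
  thus "A $$ (i, j) = B $$ (i, j)"
    using A B arg_cong[OF eq[of "unit_vec n j"], of "\<lambda>v. v $ i"] by simp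
qed (use A B in auto)

lemma mat_range_mult_vec:
  "A \<in> carrier_mat m n \<Longrightarrow> x \<in> carrier_vec n \<Longrightarrow> A *\<^sub>v x \<in> mat_range A"
  by (simp add: mat_range_def)

lemma mat_rangeE:
  assumes "y \<in> mat_range A" "A \<in> carrier_mat m n"
  obtains x where "x \<in> carrier_vec n" "y = A *\<^sub>v x"
  using assms unfolding mat_range_def by (metis carrier_matD(2) imageE)

text \<open>For uniqueness, let \<open>Q\<close> be another projector. Then \<open>x - Q x\<close>
  is orthogonal to the range of \<open>P\<close>, so \<open>P\<close> kills it, while
  \<open>P\<close> fixes \<open>Q x\<close>; hence \<open>P x = Q x\<close>.\<close>

lemma orth_proj_eqI:
  assumes "P \<in> carrier_mat n n" "P\<^sup>T = P" "P * P = P" "mat_range P = S"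
  shows "orth_proj n S = P"
  unfolding orth_proj_def
proof (rule the_equality)
  have d [simp]: "dim_row P = n" "dim_col P = n" using assms by auto
  show "is_orth_proj n S P"
    unfolding is_orth_proj_def
  proof (intro conjI ballI)
    fix x s :: "real vec" assume x: "x \<in> carrier_vec n"
    show "P *\<^sub>v x \<in> S" using x assms(4) by (auto simp: mat_range_def)
    assume "s \<in> S"
    then obtain y where y: "y \<in> carrier_vec n" "s = P *\<^sub>v y"
      using assms(4) by (auto simp: mat_range_def)
    have "s \<bullet> (x - P *\<^sub>v x) = y \<bullet> (P *\<^sub>v (x - P *\<^sub>v x))"
      using transpose_vec_mult_scalar[of P n n "x - P *\<^sub>v x" y] assms(1,2) x y by simp
    also have "P *\<^sub>v (x - P *\<^sub>v x) = P *\<^sub>v x - (P * P) *\<^sub>v x"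
      using assms(1) x by (simp add: mult_minus_distrib_mat_vec[of _ n n])
    also have "\<dots> = 0\<^sub>v n" using assms x by simp
    finally show "s \<bullet> (x - P *\<^sub>v x) = 0" using y by simp
  qed (rule assms(1))
  fix Q assume "is_orth_proj n S Q"
  hence Q: "Q \<in> carrier_mat n n" and QS: "\<And>x. x \<in> carrier_vec n \<Longrightarrow> Q *\<^sub>v x \<in> mat_range P"
    and Qorth: "\<And>x s. x \<in> carrier_vec n \<Longrightarrow> s \<in> mat_range P \<Longrightarrow> s \<bullet> (x - Q *\<^sub>v x) = 0"
    using assms(4) by (auto simp: is_orth_proj_def)
  show "Q = P"
  proof (rule eq_mat_by_vec[OF Q assms(1)])
    fix x :: "real vec" assume x: "x \<in> carrier_vec n"
    let ?d = "x - Q *\<^sub>v x"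
    have d: "?d \<in> carrier_vec n" using x Q by auto
    from QS[OF x] obtain y where y: "y \<in> carrier_vec n" "Q *\<^sub>v x = P *\<^sub>v y"
      by (auto simp: mat_range_def)
    have "P *\<^sub>v (P *\<^sub>v y) = (P * P) *\<^sub>v y"
      by (rule assoc_mult_mat_vec[symmetric]) (use assms(1) y in auto)
    hence PQ: "P *\<^sub>v (Q *\<^sub>v x) = Q *\<^sub>v x" using assms(3) y(2) by simp
    \<comment> \<open>By symmetry of \<open>P\<close>, this entry is the scalar product of
      \<open>?d\<close> with the image of a unit vector under \<open>P\<close>.\<close>
    have "(P *\<^sub>v ?d) $ i = 0" if i: "i < n" for i
    proof -
      have "(P *\<^sub>v ?d) $ i = unit_vec n i \<bullet> (P *\<^sub>v ?d)"
        using i assms(1) d by (intro scalar_prod_left_unit[symmetric]) auto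
      also have "\<dots> = (P *\<^sub>v unit_vec n i) \<bullet> ?d"
        using transpose_vec_mult_scalar[OF assms(1) d, of "unit_vec n i"] assms(2) by simp
      also have "\<dots> = 0" by (rule Qorth[OF x]) (auto simp: mat_range_def)
      finally show ?thesis .
    qed
    hence "P *\<^sub>v ?d = 0\<^sub>v n" by (intro eq_vecI) auto
    moreover have "P *\<^sub>v ?d = P *\<^sub>v x - Q *\<^sub>v x"
      using x Q PQ by (subst mult_minus_distrib_mat_vec[OF assms(1)]) auto
    ultimately have Pd: "P *\<^sub>v x - Q *\<^sub>v x = 0\<^sub>v n" by simp
    show "Q *\<^sub>v x = P *\<^sub>v x"
    proof (rule eq_vecI)
      fix i assume "i < dim_vec (P *\<^sub>v x)"
      hence i: "i < n" by simp
      from arg_cong[OF Pd, of "\<lambda>v. v $ i"] show "(Q *\<^sub>v x) $ i = (P *\<^sub>v x) $ i"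
        using i Q by (simp del: index_mult_mat_vec)
    qed (use Q in auto)
  qed
qed

lemma orth_proj_mat_range:
  assumes "A \<in> carrier_mat n m"
  shows "orth_proj n (mat_range A) = A * pinv A"
proof (rule orth_proj_eqI)
  have d [simp]: "dim_row A = n" "dim_col A = m" using assms by auto
  show "A * pinv A \<in> carrier_mat n n" by auto
  show "(A * pinv A)\<^sup>T = A * pinv A" by (rule transpose_mult_pinv)
  show "A * pinv A * (A * pinv A) = A * pinv A"
    by (simp add: assoc_mult_mat_dim pinv_mult_pinv)
  note pA = pinv_carrier_mat[OF assms]
  have AA: "A * pinv A \<in> carrier_mat n n" using assms pA by (rule mult_carrier_mat)
  show "mat_range (A * pinv A) = mat_range A"
  proof (intro equalityI subsetI)
    fix y assume "y \<in> mat_range (A * pinv A)"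
    then obtain x where x: "x \<in> carrier_vec n" "y = A * pinv A *\<^sub>v x"
      using AA by (rule mat_rangeE)
    show "y \<in> mat_range A"
      unfolding x(2) assoc_mult_mat_vec[OF assms pA x(1)]
      by (rule mat_range_mult_vec[OF assms mult_mat_vec_carrier[OF pA x(1)]])
  next
    fix y assume "y \<in> mat_range A"
    then obtain x where x: "x \<in> carrier_vec m" "y = A *\<^sub>v x"
      using assms by (rule mat_rangeE)
    have "A * pinv A * A = A" by (simp add: assoc_mult_mat_dim mult_pinv_mult)
    hence y: "y = A * pinv A *\<^sub>v (A *\<^sub>v x)"
      unfolding x(2) by (metis assoc_mult_mat_vec[OF AA assms x(1)])
    show "y \<in> mat_range (A * pinv A)"
      unfolding y by (rule mat_range_mult_vec[OF AA mult_mat_vec_carrier[OF assms x(1)]])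
  qed
qed

text \<open>The complement of the projector \<open>pinv A * A\<close> onto the row space:
  \<open>A\<close> annihilates it, and it fixes every vector that \<open>A\<close>
  annihilates.\<close>

lemma orth_proj_mat_kernel:
  assumes "A \<in> carrier_mat m n"
  shows "orth_proj n (mat_kernel A) = 1\<^sub>m n - pinv A * A"
proof (rule orth_proj_eqI)
  have d [simp]: "dim_row A = m" "dim_col A = n" using assms by auto
  let ?N = "1\<^sub>m n - pinv A * A"
  show N: "?N \<in> carrier_mat n n" by auto
  show "?N\<^sup>T = ?N" by (subst transpose_minus_dim) (simp_all add: transpose_pinv_mult)
  have "pinv A * (A * (pinv A * A)) = pinv A * A" by (simp only: mult_pinv_mult)
  thus "?N * ?N = ?N" by (simp add: mat_dim_simps)
  note pA = pinv_carrier_mat[OF assms]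
  show "mat_range ?N = mat_kernel A"
  proof (intro equalityI subsetI)
    fix y assume "y \<in> mat_range ?N"
    then obtain x where x: "x \<in> carrier_vec n" "y = ?N *\<^sub>v x" using N by (rule mat_rangeE)
    have "A * ?N = 0\<^sub>m m n" by (simp add: mat_dim_simps mult_pinv_mult)
    hence "A *\<^sub>v y = 0\<^sub>m m n *\<^sub>v x"
      unfolding x(2) by (metis assoc_mult_mat_vec[OF assms N x(1)])
    also have "\<dots> = 0\<^sub>v m" using x(1) by (intro eq_vecI) auto
    finally have "A *\<^sub>v y = 0\<^sub>v m" .
    thus "y \<in> mat_kernel A"
      using mult_mat_vec_carrier[OF N x(1)] unfolding x(2)[symmetric]
      by (intro mat_kernelI[OF assms])
  next
    fix y assume "y \<in> mat_kernel A"
    note y = mat_kernelD[OF assms this]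
    have "?N *\<^sub>v y = 1\<^sub>m n *\<^sub>v y - pinv A * A *\<^sub>v y"
      by (rule minus_mult_distrib_mat_vec[OF _ mult_carrier_mat[OF pA assms] y(1)]) simp
    also have "\<dots> = 1\<^sub>m n *\<^sub>v y - pinv A *\<^sub>v 0\<^sub>v m"
      unfolding assoc_mult_mat_vec[OF pA assms y(1)] y(2) ..
    also have "pinv A *\<^sub>v 0\<^sub>v m = 0\<^sub>v n" using pA by (intro eq_vecI) auto
    also have "1\<^sub>m n *\<^sub>v y - 0\<^sub>v n = y" using y(1) by simp
    finally show "y \<in> mat_range ?N" using mat_range_mult_vec[OF N y(1)] by simp
  qed
qed

section \<open>The weighted pseudoinverse\<close>

text \<open>The complementary projector \<open>Z\<close> satisfies \<open>G * Z = 0\<close>, and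
  \<open>Z\<^sup>T * G * Z\<close> is the sum of the Gram matrices of \<open>A * Z\<close> and
  \<open>L * Z\<close>, so both products vanish.\<close>

lemma gram_sum_mult_range_projector:
  fixes A L :: "real mat"
  assumes "A \<in> carrier_mat m n" "L \<in> carrier_mat p n" and G: "G = A\<^sup>T * A + L\<^sup>T * L"
  shows "G * (G * pinv G) = G" "A * (G * pinv G) = A" "L * (G * pinv G) = L"
proof -
  have d [simp]: "dim_row A = m" "dim_col A = n" "dim_row L = p" "dim_col L = n"
    "dim_row G = n" "dim_col G = n" using assms by auto
  have "G\<^sup>T = G" unfolding G by (subst transpose_add[of _ n n]) (auto simp: mat_dim_simps)
  with transpose_mult_mult_pinv[of G] show GG: "G * (G * pinv G) = G" by simp
  define Z where "Z = 1\<^sub>m n - G * pinv G"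
  have Z [simp]: "dim_row Z = n" "dim_col Z = n" by (auto simp: Z_def)
  have "G * Z = 0\<^sub>m n n" by (simp add: Z_def mat_dim_simps GG)
  hence "A\<^sup>T * (A * Z) + L\<^sup>T * (L * Z) = 0\<^sub>m n n" by (simp add: G mat_dim_simps)
  hence "Z\<^sup>T * (A\<^sup>T * (A * Z) + L\<^sup>T * (L * Z)) = 0\<^sub>m n n" by simp
  moreover have "Z\<^sup>T * (A\<^sup>T * (A * Z) + L\<^sup>T * (L * Z)) = (A * Z)\<^sup>T * (A * Z) + (L * Z)\<^sup>T * (L * Z)"
    by (subst mult_add_distrib_mat[of _ n n _ n]) (auto simp: mat_dim_simps)
  ultimately have "A * Z = 0\<^sub>m m n" "L * Z = 0\<^sub>m p n"
    using sum_gram_eq_zero[of "A * Z" n "L * Z"] by auto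
  hence "A - A * (G * pinv G) = 0\<^sub>m m n" "L - L * (G * pinv G) = 0\<^sub>m p n"
    by (simp_all add: Z_def mat_dim_simps)
  from this[THEN minus_eq_zero_matD] show "A * (G * pinv G) = A" "L * (G * pinv G) = L"
    by simp_all
qed

text \<open>The definition, abbreviated \<open>W\<close>, is itself shown to meet
  \<open>fit\<close>, \<open>opt\<close> and \<open>ran\<close>; the difference
  \<open>D = W - B\<close> is then forced to vanish.\<close>

lemma weighted_pinv_I_eqI:
  fixes A L B :: "real mat"
  assumes A: "A \<in> carrier_mat m n" and L: "L \<in> carrier_mat p n" and B: "B \<in> carrier_mat n m"
    and G: "G = A\<^sup>T * A + L\<^sup>T * L"
    and fit: "A * B = A * pinv A"
    and opt: "(L * orth_proj n (mat_kernel A))\<^sup>T * (L * B) = 0\<^sub>m n m"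
    and ran: "G * (pinv G * B) = B"
  shows "weighted_pinv_I A L = B"
proof -
  have d [simp]: "dim_row A = m" "dim_col A = n" "dim_row L = p" "dim_col L = n"
    "dim_row B = n" "dim_col B = m" "dim_row G = n" "dim_col G = n" using A L B G by auto
  note Q = gram_sum_mult_range_projector[OF A L G]
  define N where "N = 1\<^sub>m n - pinv A * A"
  have dN [simp]: "dim_row N = n" "dim_col N = n" by (auto simp: N_def)
  have Neq: "orth_proj n (mat_kernel A) = N"
    unfolding N_def by (rule orth_proj_mat_kernel[OF A])
  have NT: "N\<^sup>T = N"
    unfolding N_def by (subst transpose_minus_dim) (simp_all add: transpose_pinv_mult)
  have AN: "A * N = 0\<^sub>m m n" by (simp add: N_def mat_dim_simps mult_pinv_mult)
  have N_fix: "N * Z = Z" if "A * Z = 0\<^sub>m m k" "dim_row Z = n" for Z k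
  proof -
    have "dim_col (A * Z) = k" unfolding that(1) by simp
    hence "dim_col Z = k" by simp
    thus ?thesis using that by (simp add: N_def mat_dim_simps)
  qed
  have NN: "N * N = N" using AN by (intro N_fix) auto
  define M where "M = L * N"
  have dM [simp]: "dim_row M = p" "dim_col M = n" by (auto simp: M_def)
  define W where "W = (1\<^sub>m n - pinv M * L) * pinv A"
  have dW [simp]: "dim_row W = n" "dim_col W = m" by (auto simp: W_def)
  have W: "weighted_pinv_I A L = W"
    by (simp add: weighted_pinv_I_def Neq M_def W_def)
  have W_eq: "W = pinv A - pinv M * (L * pinv A)" by (simp add: W_def mat_dim_simps)

  \<comment> \<open>From \<open>M\<^sup>T = N * L\<^sup>T\<close>. It puts the range of
    \<open>pinv M\<close> into the null space of \<open>A\<close>, so the correction term of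
    \<open>W\<close> does not affect \<open>A * W\<close>.\<close>
  have MT: "N * M\<^sup>T = M\<^sup>T"
    by (simp add: M_def transpose_mult_dim NT assoc_mult_mat_dim[symmetric] NN del: assoc_mult_mat)
  have NpM: "N * pinv M = pinv M"
  proof -
    have "N * pinv M = N * (M\<^sup>T * ((pinv M)\<^sup>T * pinv M))"
      by (subst pinv_eq_transpose_mult) simp
    also have "\<dots> = (N * M\<^sup>T) * ((pinv M)\<^sup>T * pinv M)" by (simp add: assoc_mult_mat_dim)
    also have "\<dots> = pinv M" unfolding MT by (rule pinv_eq_transpose_mult[symmetric])
    finally show ?thesis .
  qed
  have "A * pinv M = A * N * pinv M" by (simp add: NpM assoc_mult_mat_dim)
  hence ApM: "A * pinv M = 0\<^sub>m m p" by (simp add: AN)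
  have AW: "A * W = A * pinv A"
  proof -
    have "A * W = A * pinv A - A * pinv M * (L * pinv A)" by (simp add: W_eq mat_dim_simps)
    thus ?thesis by (simp add: ApM)
  qed
  have MLW: "M\<^sup>T * (L * W) = 0\<^sub>m n m"
  proof -
    \<comment> \<open>This replaces \<open>L\<close> by \<open>M\<close>, so that the normal
      equations for \<open>M\<close> apply.\<close>
    have "L * pinv M = M * pinv M" by (simp add: M_def NpM[unfolded M_def] assoc_mult_mat_dim)
    hence "M\<^sup>T * (L * pinv M) = M\<^sup>T" by (simp add: transpose_mult_mult_pinv)
    moreover have "M\<^sup>T * (L * W) = M\<^sup>T * (L * pinv A) - M\<^sup>T * (L * pinv M) * (L * pinv A)"
      by (simp add: W_eq mat_dim_simps)
    ultimately show ?thesis by simp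
  qed
  have QT: "(G * pinv G)\<^sup>T = G * pinv G" by (rule transpose_mult_pinv)
  \<comment> \<open>If the rows of \<open>Z\<close> lie in the range of \<open>G\<close>, so do the
    columns of \<open>pinv Z\<close>.\<close>
  have Q_fix: "G * pinv G * pinv Z = pinv Z" if "Z * (G * pinv G) = Z" "dim_col Z = n" for Z
  proof -
    have "G * pinv G * Z\<^sup>T = (Z * (G * pinv G))\<^sup>T"
      using that(2) by (subst transpose_mult_dim[of Z]) (simp_all add: QT)
    hence *: "G * pinv G * Z\<^sup>T = Z\<^sup>T" unfolding that(1) .
    have "G * pinv G * pinv Z = G * pinv G * (Z\<^sup>T * ((pinv Z)\<^sup>T * pinv Z))"
      by (subst pinv_eq_transpose_mult) simp
    also have "\<dots> = (G * pinv G * Z\<^sup>T) * ((pinv Z)\<^sup>T * pinv Z)"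
      using that(2) by (simp add: assoc_mult_mat_dim)
    also have "\<dots> = pinv Z" unfolding * by (rule pinv_eq_transpose_mult[symmetric])
    finally show ?thesis .
  qed
  have "M * (G * pinv G) = M"
  proof -
    define Z where "Z = 1\<^sub>m n - G * pinv G"
    have dZ [simp]: "dim_row Z = n" "dim_col Z = n" by (auto simp: Z_def)
    \<comment> \<open>The columns of \<open>Z\<close> lie in the null spaces of both
      \<open>A\<close> and \<open>L\<close>; so \<open>N\<close> fixes them and
      \<open>M * Z = L * Z = 0\<close>.\<close>
    have "N * Z = Z" by (rule N_fix[of _ n]) (simp_all add: Z_def mat_dim_simps Q)
    hence "M * Z = L * Z" by (simp add: M_def assoc_mult_mat_dim)
    also have "\<dots> = 0\<^sub>m p n" by (simp add: Z_def mat_dim_simps Q)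
    finally have "M - M * (G * pinv G) = 0\<^sub>m p n" by (simp add: Z_def mat_dim_simps)
    from minus_eq_zero_matD[OF this] show ?thesis by simp
  qed
  hence QM: "G * pinv G * pinv M = pinv M" by (rule Q_fix) simp
  have QA: "G * pinv G * pinv A = pinv A" by (rule Q_fix) (use Q in simp_all)
  have QW: "G * pinv G * W = W"
  proof -
    have "G * pinv G * W = G * pinv G * pinv A - G * pinv G * pinv M * (L * pinv A)"
      by (simp add: W_eq mat_dim_simps)
    thus ?thesis unfolding QA QM W_eq .
  qed

  define D where "D = W - B"
  have dD [simp]: "dim_row D = n" "dim_col D = m" by (auto simp: D_def)
  have AD: "A * D = 0\<^sub>m m m" by (simp add: D_def mat_dim_simps AW fit)
  hence ND: "N * D = D" by (rule N_fix) simp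
  have "M\<^sup>T * (L * D) = M\<^sup>T * (L * W) - M\<^sup>T * (L * B)" by (simp add: D_def mat_dim_simps)
  hence "M\<^sup>T * (L * D) = 0\<^sub>m n m" using MLW opt by (simp add: Neq M_def)
  \<comment> \<open>The optimality condition thereby reads \<open>M\<^sup>T * (M * D) = 0\<close>,
    from which \<open>M\<^sup>T\<close> can be cancelled.\<close>
  moreover have MD: "M * D = L * D" by (simp add: M_def ND assoc_mult_mat_dim)
  ultimately have LD: "L * D = 0\<^sub>m p m" using gram_mult_eq_zero[of M D] by simp
  have "G * D = 0\<^sub>m n m" by (simp add: G mat_dim_simps AD LD)
  moreover have "G\<^sup>T = G" unfolding G by (subst transpose_add[of _ n n]) (auto simp: mat_dim_simps)
  \<comment> \<open>Moving \<open>G\<close> to the right lets \<open>G * D = 0\<close> annihilate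
    the projector applied to \<open>D\<close>.\<close>
  hence "G * pinv G = (pinv G)\<^sup>T * G" using QT by (simp add: transpose_mult_dim)
  ultimately have "G * pinv G * D = 0\<^sub>m n m" by (simp add: assoc_mult_mat_dim)
  moreover have "G * pinv G * D = D"
    using QW ran by (simp add: D_def mat_dim_simps)
  ultimately have "W - B = 0\<^sub>m n m" unfolding D_def by simp
  hence "W = B" by (rule minus_eq_zero_matD) simp_all
  thus ?thesis unfolding W .
qed

section \<open>The generalized singular value decomposition\<close>

lemma append_zero_cols_dim [simp]:
  "dim_row (append_zero_cols B k) = dim_row B" "dim_col (append_zero_cols B k) = dim_col B + k"
  by (auto simp: append_zero_cols_def)

text \<open>The lower blocks of the padded matrix have no rows, so block multiplication applies with
  inner sizes \<open>m\<close> and 0.\<close>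

lemma gram_append_zero_cols:
  fixes B :: "real mat"
  assumes "B \<in> carrier_mat m r"
  shows "(append_zero_cols B k)\<^sup>T * append_zero_cols B k =
    four_block_mat (B\<^sup>T * B) (0\<^sub>m r k) (0\<^sub>m k r) (0\<^sub>m k k)"
proof -
  have T: "(append_zero_cols B k)\<^sup>T = four_block_mat B\<^sup>T (0\<^sub>m r 0) (0\<^sub>m k m) (0\<^sub>m k 0)"
    unfolding append_zero_cols_def
    by (subst transpose_four_block_mat[of _ m r _ k _ 0]) (use assms in auto)
  show ?thesis
    unfolding T unfolding append_zero_cols_def
    by (subst mult_four_block_mat[of _ r m _ 0 _ k _ _ r _ k]) (use assms in auto)
qed

lemma append_zero_cols_mult_block_one:
  fixes B :: "real mat"
  assumes "B \<in> carrier_mat m r"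
  shows "append_zero_cols B k * four_block_mat (1\<^sub>m r) (0\<^sub>m r k) (0\<^sub>m k r) (0\<^sub>m k k) =
    append_zero_cols B k"
  unfolding append_zero_cols_def
  by (subst mult_four_block_mat[of _ m r _ k _ 0 _ _ r _ k]) (use assms in auto)

text \<open>\<open>Y\<close> is the inverse of \<open>X\<close>, and \<open>J\<close> is the
  identity of size \<open>r\<close> bordered by zeros, which is what the normalization of the two
  block diagonal factors becomes after padding.\<close>

lemma is_gsvdD:
  assumes "is_gsvd m n p A L U\<^sub>A \<Sigma>\<^sub>A U\<^sub>L \<Sigma>\<^sub>L X"
  obtains Y J where
    "U\<^sub>A \<in> carrier_mat m m" "U\<^sub>A\<^sup>T * U\<^sub>A = 1\<^sub>m m" "U\<^sub>L \<in> carrier_mat p p" "U\<^sub>L\<^sup>T * U\<^sub>L = 1\<^sub>m p"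
    "X \<in> carrier_mat n n" "Y \<in> carrier_mat n n" "Y * X = 1\<^sub>m n" "J \<in> carrier_mat n n"
    "\<Sigma>\<^sub>A \<in> carrier_mat m n" "\<Sigma>\<^sub>L \<in> carrier_mat p n" "A = U\<^sub>A * \<Sigma>\<^sub>A * Y" "L = U\<^sub>L * \<Sigma>\<^sub>L * Y"
    "\<Sigma>\<^sub>A\<^sup>T * \<Sigma>\<^sub>A + \<Sigma>\<^sub>L\<^sup>T * \<Sigma>\<^sub>L = J" "J\<^sup>T = J" "\<Sigma>\<^sub>A * J = \<Sigma>\<^sub>A"
proof -
  from assms obtain q1 q2 q3 r Cq Sq C S where
    r: "r = q1 + q2 + q3" "r \<le> n" "q1 + q2 \<le> m" "q2 + q3 \<le> p"
    and q: "pos_diagonal q2 Cq" "pos_diagonal q2 Sq"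
    and C: "C = diag_block_mat [1\<^sub>m q1, Cq, 0\<^sub>m (m - (q1 + q2)) q3]"
    and S: "S = diag_block_mat [0\<^sub>m (p - (q2 + q3)) q1, Sq, 1\<^sub>m q3]"
    and CS: "C\<^sup>T * C + S\<^sup>T * S = 1\<^sub>m r"
    and \<Sigma>: "\<Sigma>\<^sub>A = append_zero_cols C (n - r)" "\<Sigma>\<^sub>L = append_zero_cols S (n - r)"
    unfolding is_gsvd_def by blast
  have q': "dim_row Cq = q2" "dim_col Cq = q2" "dim_row Sq = q2" "dim_col Sq = q2"
    using q by (auto simp: pos_diagonal_def)
  have Cc: "C \<in> carrier_mat m r" and Sc: "S \<in> carrier_mat p r"
    using r q' by (auto simp: C S dim_diag_block_mat intro!: carrier_matI simp del: diag_block_mat.simps)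
  define k where "k = n - r"
  have n: "n = r + k" using r by (simp add: k_def)
  define J where "J = four_block_mat (1\<^sub>m r) (0\<^sub>m r k) (0\<^sub>m k r) (0\<^sub>m k k :: real mat)"
  have J: "J \<in> carrier_mat n n" by (auto simp: J_def n)
  have sum: "\<Sigma>\<^sub>A\<^sup>T * \<Sigma>\<^sub>A + \<Sigma>\<^sub>L\<^sup>T * \<Sigma>\<^sub>L = J"
    unfolding \<Sigma> k_def[symmetric] gram_append_zero_cols[OF Cc] gram_append_zero_cols[OF Sc] J_def
    by (subst add_four_block_mat[of _ r r _ k _ k]) (use Cc Sc CS in auto)
  have JT: "J\<^sup>T = J"
    unfolding J_def by (subst transpose_four_block_mat[of _ r r _ k _ k]) auto
  have \<Sigma>J: "\<Sigma>\<^sub>A * J = \<Sigma>\<^sub>A"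
    unfolding \<Sigma> k_def[symmetric] J_def by (rule append_zero_cols_mult_block_one[OF Cc])
  have X: "X \<in> carrier_mat n n" "invertible_mat X" using assms by (auto simp: is_gsvd_def)
  from X obtain Z where Z: "X * Z = 1\<^sub>m n" "Z * X = 1\<^sub>m (dim_row Z)"
    unfolding invertible_mat_def inverts_mat_def by auto
  \<comment> \<open>The columns of \<open>Z\<close> are counted by \<open>X * Z = 1\<close>, its
    rows by the size of the identity in \<open>Z * X\<close>.\<close>
  have "Z \<in> carrier_mat n n"
    using arg_cong[OF Z(1), of dim_col] arg_cong[OF Z(2), of dim_col] X(1) by auto
  \<comment> \<open>\<open>mat_inverse\<close> is known to succeed on units of the matrix ring;
    \<open>undefined\<close> fills a dummy argument of \<open>ring_mat\<close>.\<close>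
  with X(1) Z have "X \<in> Units (ring_mat TYPE(real) n undefined)"
    unfolding Units_def ring_mat_def by auto
  with mat_inverse(1)[OF X(1), of undefined] obtain Y where Y: "mat_inverse X = Some Y"
    by (cases "mat_inverse X") auto
  note Y' = mat_inverse(2)[OF X(1) Y]
  have U: "is_orthogonal m U\<^sub>A" "is_orthogonal p U\<^sub>L"
    and AL: "A = U\<^sub>A * \<Sigma>\<^sub>A * Y" "L = U\<^sub>L * \<Sigma>\<^sub>L * Y"
    using assms Y unfolding is_gsvd_def by auto
  have "\<Sigma>\<^sub>A \<in> carrier_mat m n" "\<Sigma>\<^sub>L \<in> carrier_mat p n"
    using Cc Sc r(2) by (auto simp: \<Sigma> intro!: carrier_matI)
  with U Y' show thesis
    unfolding is_orthogonal_def by (intro that[of Y J] X(1) J AL sum JT \<Sigma>J) blast+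
qed

theorem theorem3p10:
  fixes m n p :: nat
    and A L G U\<^sub>A \<Sigma>\<^sub>A U\<^sub>L \<Sigma>\<^sub>L X :: "real mat"
  assumes "A \<in> carrier_mat m n"
    and "L \<in> carrier_mat p n"
    and "G = A\<^sup>T * A + L\<^sup>T * L"
    and "is_gsvd m n p A L U\<^sub>A \<Sigma>\<^sub>A U\<^sub>L \<Sigma>\<^sub>L X"
  shows "weighted_pinv_I A L = orth_proj n (mat_range G) * X * pinv \<Sigma>\<^sub>A * U\<^sub>A\<^sup>T"
proof -
  from is_gsvdD[OF assms(4)] obtain Y J where
    gsvd: "U\<^sub>A \<in> carrier_mat m m" "U\<^sub>A\<^sup>T * U\<^sub>A = 1\<^sub>m m" "U\<^sub>L \<in> carrier_mat p p" "U\<^sub>L\<^sup>T * U\<^sub>L = 1\<^sub>m p"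
    "X \<in> carrier_mat n n" "Y \<in> carrier_mat n n" "Y * X = 1\<^sub>m n" "J \<in> carrier_mat n n"
    "\<Sigma>\<^sub>A \<in> carrier_mat m n" "\<Sigma>\<^sub>L \<in> carrier_mat p n" and A_eq: "A = U\<^sub>A * \<Sigma>\<^sub>A * Y"
    and L_eq: "L = U\<^sub>L * \<Sigma>\<^sub>L * Y"
    and J: "\<Sigma>\<^sub>A\<^sup>T * \<Sigma>\<^sub>A + \<Sigma>\<^sub>L\<^sup>T * \<Sigma>\<^sub>L = J" "J\<^sup>T = J" "\<Sigma>\<^sub>A * J = \<Sigma>\<^sub>A" .
  have d [simp]: "dim_row A = m" "dim_col A = n" "dim_row L = p" "dim_col L = n"
    "dim_row G = n" "dim_col G = n" "dim_row U\<^sub>A = m" "dim_col U\<^sub>A = m"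
    "dim_row U\<^sub>L = p" "dim_col U\<^sub>L = p" "dim_row X = n" "dim_col X = n"
    "dim_row Y = n" "dim_col Y = n" "dim_row J = n" "dim_col J = n"
    "dim_row \<Sigma>\<^sub>A = m" "dim_col \<Sigma>\<^sub>A = n" "dim_row \<Sigma>\<^sub>L = p" "dim_col \<Sigma>\<^sub>L = n"
    using assms gsvd by auto
  note Q = gram_sum_mult_range_projector[OF assms(1-3)]
  let ?S = "pinv \<Sigma>\<^sub>A" and ?P = "G * pinv G"
  define B where "B = ?P * X * ?S * U\<^sub>A\<^sup>T"
  have dB [simp]: "dim_row B = n" "dim_col B = m" by (auto simp: B_def)
  \<comment> \<open>Each of \<open>A\<close>, \<open>L\<close> and \<open>?P\<close> absorbs the
    projector at the front of \<open>B\<close>.\<close>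
  have proj_mult: "Z * B = Z * X * ?S * U\<^sub>A\<^sup>T" if "Z * ?P = Z" "dim_col Z = n" for Z
  proof -
    have "Z * B = Z * ?P * X * ?S * U\<^sub>A\<^sup>T" using that(2) by (simp add: B_def assoc_mult_mat_dim)
    thus ?thesis unfolding that(1) .
  qed

  \<comment> \<open>The least squares condition\<close>
  have AX: "A * X = U\<^sub>A * \<Sigma>\<^sub>A" and LX: "L * X = U\<^sub>L * \<Sigma>\<^sub>L"
    using gsvd(7) by (simp_all add: A_eq L_eq assoc_mult_mat_dim)
  define F where "F = A * B"
  have dF [simp]: "dim_row F = m" "dim_col F = m" by (auto simp: F_def)
  have F: "F = U\<^sub>A * (\<Sigma>\<^sub>A * ?S) * U\<^sub>A\<^sup>T"
    unfolding F_def proj_mult[OF Q(2) d(2)] AX by (simp add: assoc_mult_mat_dim)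
  have "F\<^sup>T = U\<^sub>A * (\<Sigma>\<^sub>A * ?S)\<^sup>T * U\<^sub>A\<^sup>T" by (simp add: F mat_dim_simps)
  hence FT: "F\<^sup>T = F" unfolding transpose_mult_pinv F .
  have FA: "F * A = A"
  proof -
    have "F * A = U\<^sub>A * (\<Sigma>\<^sub>A * ?S) * (U\<^sub>A\<^sup>T * U\<^sub>A) * (\<Sigma>\<^sub>A * Y)"
      by (simp add: F A_eq assoc_mult_mat_dim)
    also have "\<dots> = U\<^sub>A * (\<Sigma>\<^sub>A * (?S * \<Sigma>\<^sub>A)) * Y"
      unfolding gsvd(2) by (simp add: assoc_mult_mat_dim)
    finally show ?thesis by (simp add: mult_pinv_mult A_eq)
  qed
  have fit: "A * B = A * pinv A"
  proof -
    \<comment> \<open>Transposing \<open>F = (A * pinv A) * F\<close>, where both factors are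
      symmetric, moves \<open>F\<close> next to \<open>A\<close>, where \<open>F * A = A\<close>
      applies.\<close>
    have "F = (A * (pinv A * A)) * B" unfolding mult_pinv_mult F_def ..
    also have "\<dots> = (A * pinv A) * F" by (simp add: F_def assoc_mult_mat_dim)
    finally have "F\<^sup>T = F\<^sup>T * (A * pinv A)\<^sup>T"
      by (metis transpose_mult_dim dF(1) index_mult_mat(3) pinv_dim(2) d(1))
    also have "\<dots> = F * A * pinv A"
      unfolding FT transpose_mult_pinv by (simp add: assoc_mult_mat_dim)
    finally have "F = A * pinv A" unfolding FA FT .
    thus ?thesis unfolding F_def .
  qed

  \<comment> \<open>The minimal seminorm condition\<close>
  define N where "N = orth_proj n (mat_kernel A)"
  have N: "N = 1\<^sub>m n - pinv A * A" unfolding N_def by (rule orth_proj_mat_kernel[OF assms(1)])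
  have dN [simp]: "dim_row N = n" "dim_col N = n" by (auto simp: N)
  have "(A * N)\<^sup>T = (0\<^sub>m m n)\<^sup>T" by (simp add: N mat_dim_simps mult_pinv_mult)
  hence NA: "N\<^sup>T * A\<^sup>T = 0\<^sub>m n m" by (simp add: transpose_mult_dim)
  have J\<Sigma>: "J * \<Sigma>\<^sub>A\<^sup>T = \<Sigma>\<^sub>A\<^sup>T"
    using arg_cong[OF J(3), of transpose_mat] J(2) by (simp add: transpose_mult_dim)
  \<comment> \<open>\<open>K\<close> is the cofactor in \<open>pinv_eq_transpose_mult\<close>; with
    it \<open>J\<close> fixes \<open>?S\<close>, because \<open>J\<close> fixes
    \<open>\<Sigma>\<^sub>A\<^sup>T\<close>.\<close>
  define K where "K = (?S)\<^sup>T * ?S"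
  have dK [simp]: "dim_row K = m" "dim_col K = m" by (auto simp: K_def)
  have SK: "?S = \<Sigma>\<^sub>A\<^sup>T * K" unfolding K_def by (rule pinv_eq_transpose_mult)
  have "J * ?S = J * \<Sigma>\<^sub>A\<^sup>T * K" by (subst SK) (simp add: assoc_mult_mat_dim)
  hence JS: "J * ?S = \<Sigma>\<^sub>A\<^sup>T * K" unfolding J\<Sigma> .
  have LL: "\<Sigma>\<^sub>L\<^sup>T * \<Sigma>\<^sub>L = J - \<Sigma>\<^sub>A\<^sup>T * \<Sigma>\<^sub>A"
    unfolding J(1)[symmetric] by (intro eq_matI) auto
  \<comment> \<open>A factor \<open>\<Sigma>\<^sub>A\<^sup>T\<close> on the left puts the columns of
    \<open>L\<^sup>T * (L * B)\<close> into the range of \<open>A\<^sup>T\<close>, which is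
    orthogonal to the null space of \<open>A\<close>.\<close>
  have LS: "\<Sigma>\<^sub>L\<^sup>T * (\<Sigma>\<^sub>L * ?S) = \<Sigma>\<^sub>A\<^sup>T * (K - 1\<^sub>m m)"
  proof -
    have "\<Sigma>\<^sub>L\<^sup>T * (\<Sigma>\<^sub>L * ?S) = (\<Sigma>\<^sub>L\<^sup>T * \<Sigma>\<^sub>L) * ?S" by (simp add: assoc_mult_mat_dim)
    also have "\<dots> = J * ?S - \<Sigma>\<^sub>A\<^sup>T * (\<Sigma>\<^sub>A * ?S)" unfolding LL by (simp add: mat_dim_simps)
    also have "\<dots> = \<Sigma>\<^sub>A\<^sup>T * (K - 1\<^sub>m m)"
      unfolding JS transpose_mult_mult_pinv by (simp add: mat_dim_simps)
    finally show ?thesis .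
  qed
  have AU: "A\<^sup>T * U\<^sub>A = Y\<^sup>T * \<Sigma>\<^sub>A\<^sup>T"
    using gsvd(2) by (simp add: A_eq mat_dim_simps)
  have "L\<^sup>T * (L * B) = Y\<^sup>T * \<Sigma>\<^sub>L\<^sup>T * (U\<^sub>L\<^sup>T * U\<^sub>L) * (\<Sigma>\<^sub>L * ?S * U\<^sub>A\<^sup>T)"
    unfolding proj_mult[OF Q(3) d(4)] LX by (subst L_eq) (simp add: mat_dim_simps)
  also have "\<dots> = Y\<^sup>T * (\<Sigma>\<^sub>L\<^sup>T * (\<Sigma>\<^sub>L * ?S)) * U\<^sub>A\<^sup>T"
    unfolding gsvd(4) by (simp add: assoc_mult_mat_dim)
  also have "\<dots> = Y\<^sup>T * \<Sigma>\<^sub>A\<^sup>T * ((K - 1\<^sub>m m) * U\<^sub>A\<^sup>T)"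
    unfolding LS by (simp add: assoc_mult_mat_dim)
  also have "\<dots> = A\<^sup>T * (U\<^sub>A * ((K - 1\<^sub>m m) * U\<^sub>A\<^sup>T))"
    unfolding AU[symmetric] by (simp add: assoc_mult_mat_dim)
  finally have LLB: "L\<^sup>T * (L * B) = A\<^sup>T * (U\<^sub>A * ((K - 1\<^sub>m m) * U\<^sub>A\<^sup>T))" .
  have "(L * N)\<^sup>T * (L * B) = N\<^sup>T * (L\<^sup>T * (L * B))" by (simp add: mat_dim_simps)
  also have "\<dots> = N\<^sup>T * A\<^sup>T * (U\<^sub>A * ((K - 1\<^sub>m m) * U\<^sub>A\<^sup>T))"
    unfolding LLB by (simp add: assoc_mult_mat_dim)
  also have "\<dots> = 0\<^sub>m n m" unfolding NA by simp
  finally have opt: "(L * N)\<^sup>T * (L * B) = 0\<^sub>m n m" .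

  \<comment> \<open>The range condition and the conclusion\<close>
  have "G * (pinv G * B) = ?P * B" by (simp add: assoc_mult_mat_dim)
  also have "\<dots> = B"
    by (subst proj_mult) (simp_all add: B_def, simp add: assoc_mult_mat_dim pinv_mult_pinv)
  finally have "weighted_pinv_I A L = B"
    using fit opt unfolding N_def
    by (intro weighted_pinv_I_eqI[OF assms(1,2) _ assms(3)]) auto
  moreover have "orth_proj n (mat_range G) = ?P"
    by (rule orth_proj_mat_range[of _ _ n]) auto
  ultimately show ?thesis unfolding B_def by simp
qed

end
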